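(* Let $T$ be a complete one-sorted first-order theory. Suppose that $\exists^\infty$ is eliminated on every set of unary imaginaries (in models of $T$). Then $T^{\mathrm{eq}}$ eliminates $\exists^\infty$, i.e. $\exists^\infty$ is eliminated on every interpretable set.
   Context: Let $X$ be a definable or interpretable set in a structure $M$. We say $\exists^\infty$ is eliminated on $X$ if for every definable family $\{D_a\}_{a\in Y}$ of subsets of $X$ there is $n\in\mathbb{N}$ such that for all $a\in Y$, $|D_a|$ is infinite if and only if $|D_a|>n$ (equivalently, in an $\aleph_0$-saturated elementary extension, the set $\{a\in Y: D_a \text{ infinite}\}$ is definable). A theory eliminates $\exists^\infty$ (has uniform finiteness) if $\exists^\infty$ is eliminated on every definable set; $T^{\mathrm{eq}}$ eliminates $\exists^\infty$ means $\exists^\infty$ is eliminated on every interpretable set of models of $T$. For a model $M\models T$, a unary definable set is a definable subset of $M=M^1$. An interpretable set $X$ is a set of unary imaginaries if there is a definable relation $R\subseteq X\times M$ such that the map $x\mapsto R_x:=\{m\in M:(x,m)\in R\}$ is injective on $X$. *)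

theory Defs
  imports Main "HOL-Library.Equipollence"
begin

text \<open>One-sorted first-order logic with equality.  A language assigns arities to those elements of
  \<open>'f\<close> and \<open>'r\<close> that are symbols of the language; the maps are partial because HOL types are
  nonempty, whereas a language may have no function or no relation symbols.\<close>

record ('f, 'r) language =
  fun_arity :: "'f \<rightharpoonup> nat"
  rel_arity :: "'r \<rightharpoonup> nat"

datatype 'f tm = Var nat | Fn 'f "'f tm list"

datatype ('f, 'r) fm =
    Eq "'f tm" "'f tm"
  | Rel 'r "'f tm list"
  | Neg "('f, 'r) fm"
  | Conj "('f, 'r) fm" "('f, 'r) fm"
  | Exists nat "('f, 'r) fm"

primrec is_term :: "('f, 'r) language \<Rightarrow> 'f tm \<Rightarrow> bool" where
  "is_term L (Var i) \<longleftrightarrow> True"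
| "is_term L (Fn f ts) \<longleftrightarrow> fun_arity L f = Some (length ts) \<and> list_all (is_term L) ts"

primrec is_formula :: "('f, 'r) language \<Rightarrow> ('f, 'r) fm \<Rightarrow> bool" where
  "is_formula L (Eq s t) \<longleftrightarrow> is_term L s \<and> is_term L t"
| "is_formula L (Rel r ts) \<longleftrightarrow> rel_arity L r = Some (length ts) \<and> list_all (is_term L) ts"
| "is_formula L (Neg p) \<longleftrightarrow> is_formula L p"
| "is_formula L (Conj p q) \<longleftrightarrow> is_formula L p \<and> is_formula L q"
| "is_formula L (Exists i p) \<longleftrightarrow> is_formula L p"

primrec tm_vars :: "'f tm \<Rightarrow> nat set" where
  "tm_vars (Var i) = {i}"
| "tm_vars (Fn f ts) = \<Union> (set (map tm_vars ts))"

primrec free_vars :: "('f, 'r) fm \<Rightarrow> nat set" where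
  "free_vars (Eq s t) = tm_vars s \<union> tm_vars t"
| "free_vars (Rel r ts) = \<Union> (set (map tm_vars ts))"
| "free_vars (Neg p) = free_vars p"
| "free_vars (Conj p q) = free_vars p \<union> free_vars q"
| "free_vars (Exists i p) = free_vars p - {i}"

definition is_sentence :: "('f, 'r) language \<Rightarrow> ('f, 'r) fm \<Rightarrow> bool" where
  "is_sentence L p \<longleftrightarrow> is_formula L p \<and> free_vars p = {}"

record ('f, 'r, 'm) struct =
  univ :: "'m set"
  fun_interp :: "'f \<Rightarrow> 'm list \<Rightarrow> 'm"
  rel_interp :: "'r \<Rightarrow> 'm list \<Rightarrow> bool"

definition tuples :: "'a set \<Rightarrow> nat \<Rightarrow> 'a list set" where
  "tuples A n = {xs. set xs \<subseteq> A \<and> length xs = n}"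

text \<open>The values of the interpretations at non-symbols, and at tuples of the wrong length or outside
  the universe, are junk: no formula of the language refers to them.\<close>

definition is_structure :: "('f, 'r) language \<Rightarrow> ('f, 'r, 'm) struct \<Rightarrow> bool" where
  "is_structure L M \<longleftrightarrow> univ M \<noteq> {} \<and>
     (\<forall>f n. fun_arity L f = Some n \<longrightarrow> (\<forall>xs \<in> tuples (univ M) n. fun_interp M f xs \<in> univ M))"

primrec tm_val :: "('f, 'r, 'm) struct \<Rightarrow> (nat \<Rightarrow> 'm) \<Rightarrow> 'f tm \<Rightarrow> 'm" where
  "tm_val M e (Var i) = e i"
| "tm_val M e (Fn f ts) = fun_interp M f (map (tm_val M e) ts)"

primrec sat :: "('f, 'r, 'm) struct \<Rightarrow> (nat \<Rightarrow> 'm) \<Rightarrow> ('f, 'r) fm \<Rightarrow> bool" where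
  "sat M e (Eq s t) \<longleftrightarrow> tm_val M e s = tm_val M e t"
| "sat M e (Rel r ts) \<longleftrightarrow> rel_interp M r (map (tm_val M e) ts)"
| "sat M e (Neg p) \<longleftrightarrow> \<not> sat M e p"
| "sat M e (Conj p q) \<longleftrightarrow> sat M e p \<and> sat M e q"
| "sat M e (Exists i p) \<longleftrightarrow> (\<exists>a \<in> univ M. sat M (e(i := a)) p)"

definition holds :: "('f, 'r, 'm) struct \<Rightarrow> ('f, 'r) fm \<Rightarrow> bool" where
  "holds M p \<longleftrightarrow> (\<forall>e. range e \<subseteq> univ M \<longrightarrow> sat M e p)"

definition is_model ::
  "('f, 'r) language \<Rightarrow> ('f, 'r) fm set \<Rightarrow> ('f, 'r, 'm) struct \<Rightarrow> bool" where
  "is_model L T M \<longleftrightarrow> is_structure L M \<and> (\<forall>p \<in> T. holds M p)"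

text \<open>HOL cannot quantify over all types inside a formula, so the notions that refer to all models
  of a theory refer to all models whose universe is a subset of a given type \<open>'m\<close>.  If \<open>'m\<close> has at
  least as many elements as there are formulas of the language, the downward Loewenheim-Skolem
  theorem shows that consistency, consequence and completeness do not depend on \<open>'m\<close>.\<close>

definition entails ::
  "'m itself \<Rightarrow> ('f, 'r) language \<Rightarrow> ('f, 'r) fm set \<Rightarrow> ('f, 'r) fm \<Rightarrow> bool" where
  "entails (_ :: 'm itself) L T p \<longleftrightarrow> (\<forall>M :: ('f, 'r, 'm) struct. is_model L T M \<longrightarrow> holds M p)"

definition complete_theory ::
  "'m itself \<Rightarrow> ('f, 'r) language \<Rightarrow> ('f, 'r) fm set \<Rightarrow> bool" where
  "complete_theory (U :: 'm itself) L T \<longleftrightarrow>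
     (\<forall>p \<in> T. is_sentence L p) \<and>
     (\<exists>M :: ('f, 'r, 'm) struct. is_model L T M) \<and>
     (\<forall>p. is_sentence L p \<longrightarrow> entails U L T p \<or> entails U L T (Neg p))"

text \<open>Definable means definable with parameters.  In a formula defining a subset of \<open>M\<^sup>n\<close> the variables
  below \<open>n\<close> are the coordinates; the other variables are assigned parameters by \<open>e\<close>.  Only the
  finitely many \<open>e i\<close> with \<open>i\<close> free in the formula matter.\<close>

definition definable ::
  "('f, 'r) language \<Rightarrow> ('f, 'r, 'm) struct \<Rightarrow> nat \<Rightarrow> 'm list set \<Rightarrow> bool" where
  "definable L M n D \<longleftrightarrow>
     (\<exists>p e. is_formula L p \<and> range e \<subseteq> univ M \<and>
        D = {xs \<in> tuples (univ M) n. sat M (\<lambda>i. if i < n then xs ! i else e i) p})"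

text \<open>An interpretable set is the set of classes of a definable equivalence relation on a definable
  set \<open>D \<subseteq> M\<^sup>n\<close>.  A subset of a product involving interpretable sets is definable if its preimage
  in the product of the covering sets (a set of concatenated tuples) is definable.\<close>

definition interpretable ::
  "('f, 'r) language \<Rightarrow> ('f, 'r, 'm) struct \<Rightarrow> nat \<Rightarrow> 'm list set set \<Rightarrow> bool" where
  "interpretable L M n X \<longleftrightarrow>
     (\<exists>D E. definable L M n D \<and> equiv D E \<and>
        definable L M (n + n) {xs @ ys | xs ys. (xs, ys) \<in> E} \<and> X = D // E)"

definition definable_family ::
  "('f, 'r) language \<Rightarrow> ('f, 'r, 'm) struct \<Rightarrow> nat \<Rightarrow> 'm list set set \<Rightarrow>
     nat \<Rightarrow> 'm list set \<Rightarrow> ('m list \<Rightarrow> 'm list set set) \<Rightarrow> bool" where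
  "definable_family L M n X k Y F \<longleftrightarrow>
     definable L M k Y \<and> (\<forall>a \<in> Y. F a \<subseteq> X) \<and>
     definable L M (k + n) {a @ xs | a xs. a \<in> Y \<and> (\<exists>x \<in> F a. xs \<in> x)}"

text \<open>\<open>{..<N} \<prec> F a\<close> expresses that \<open>F a\<close> has more than \<open>N\<close> elements, possibly infinitely many;
  \<open>card\<close> would be \<open>0\<close> in the latter case.\<close>

definition eliminates_ex_inf ::
  "('f, 'r) language \<Rightarrow> ('f, 'r, 'm) struct \<Rightarrow> nat \<Rightarrow> 'm list set set \<Rightarrow> bool" where
  "eliminates_ex_inf L M n X \<longleftrightarrow>
     (\<forall>k Y F. definable_family L M n X k Y F \<longrightarrow>
        (\<exists>N :: nat. \<forall>a \<in> Y. infinite (F a) \<longleftrightarrow> {..<N} \<prec> F a))"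

definition unary_imaginaries ::
  "('f, 'r) language \<Rightarrow> ('f, 'r, 'm) struct \<Rightarrow> nat \<Rightarrow> 'm list set set \<Rightarrow> bool" where
  "unary_imaginaries L M n X \<longleftrightarrow>
     interpretable L M n X \<and>
     (\<exists>R \<subseteq> X \<times> univ M.
        definable L M (n + 1) {xs @ [m] | xs m. \<exists>x. xs \<in> x \<and> (x, m) \<in> R} \<and>
        inj_on (\<lambda>x. {m \<in> univ M. (x, m) \<in> R}) X)"

end

theory Submission
  imports Defs
begin

text \<open>The argument takes place in a fixed model \<open>M\<close>.  An interpretable set is, through the classes,
  a definable family of pairwise distinct subsets \<open>S\<^sub>a\<close> of \<open>M\<^sup>n\<close>, and one bounds the finite
  definable subfamilies by induction on \<open>n\<close>; for \<open>n = 1\<close> this is the hypothesis on unary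
  imaginaries.  Let \<open>A\<close> be a finite definable family of subsets of \<open>M \<times> M\<^sup>n\<close>.  By induction each
  point \<open>m\<close> of \<open>M\<close> gives at most \<open>N\<close> slices of members of \<open>A\<close>, and by the case \<open>n = 1\<close> each \<open>u\<close> in
  \<open>A\<close> gives at most \<open>K\<close> sets \<open>{m. u\<^sub>m = v\<^sub>m}\<close> with \<open>v\<close> in \<open>A\<close>, both uniformly in the parameters.
  Then \<open>A\<close> has at most \<open>K ^ N\<close> elements: fix \<open>u\<close> and partition \<open>A\<close> into \<open>K\<close> parts according
  to the agreement set \<open>C\<close> with \<open>u\<close>.  Members of one part have equal slices on \<open>C\<close>, and outside
  \<open>C\<close> they miss the slice of \<open>u\<close>, so that \<open>N\<close> drops by one.\<close>

section \<open>Renaming of variables\<close>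

primrec rename_tm :: "(nat \<Rightarrow> nat) \<Rightarrow> 'f tm \<Rightarrow> 'f tm" where
  "rename_tm f (Var i) = Var (f i)"
| "rename_tm f (Fn g ts) = Fn g (map (rename_tm f) ts)"

text \<open>The bound variable is replaced by one outside the image of the free variables, so that
  nothing is captured even if \<open>f\<close> is not injective; conjunctions below send several
  variables to one coordinate.\<close>

primrec rename :: "(nat \<Rightarrow> nat) \<Rightarrow> ('f, 'r) fm \<Rightarrow> ('f, 'r) fm" where
  "rename f (Eq s t) = Eq (rename_tm f s) (rename_tm f t)"
| "rename f (Rel r ts) = Rel r (map (rename_tm f) ts)"
| "rename f (Neg p) = Neg (rename f p)"
| "rename f (Conj p q) = Conj (rename f p) (rename f q)"
| "rename f (Exists i p) =
     (let z = (SOME z. z \<notin> f ` free_vars p) in Exists z (rename (f(i := z)) p))"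

lemma is_term_rename_tm: "is_term L (rename_tm f t) \<longleftrightarrow> is_term L t"
  by (induction t) (auto simp: list_all_iff)

lemma is_formula_rename: "is_formula L (rename f p) \<longleftrightarrow> is_formula L p"
  by (induction p arbitrary: f) (auto simp: list_all_iff is_term_rename_tm Let_def)

lemma finite_tm_vars: "finite (tm_vars t)"
  by (induction t) auto

lemma finite_free_vars: "finite (free_vars p)"
  by (induction p) (auto simp: finite_tm_vars)

lemma tm_val_cong: "(\<And>i. i \<in> tm_vars t \<Longrightarrow> d i = e i) \<Longrightarrow> tm_val M d t = tm_val M e t"
proof (induction t)
  case (Fn g ts)
  then have "map (tm_val M d) ts = map (tm_val M e) ts"
    by auto
  then show ?case by (simp del: map_eq_conv)
qed simp

lemma sat_cong: "(\<And>i. i \<in> free_vars p \<Longrightarrow> d i = e i) \<Longrightarrow> sat M d p = sat M e p"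
proof (induction p arbitrary: d e)
  case (Eq s t)
  then show ?case using tm_val_cong[of s d e M] tm_val_cong[of t d e M] by simp
next
  case (Rel r ts)
  then have "map (tm_val M d) ts = map (tm_val M e) ts"
    by (auto intro!: tm_val_cong)
  then show ?case by (simp del: map_eq_conv)
next
  case (Neg p)
  have "sat M d p = sat M e p"
    by (rule Neg.IH) (simp add: Neg.prems)
  then show ?case by simp
next
  case (Conj p q)
  have "sat M d p = sat M e p" "sat M d q = sat M e q"
    by (rule Conj.IH; simp add: Conj.prems)+
  then show ?case by simp
next
  case (Exists i p)
  have "sat M (d(i := a)) p = sat M (e(i := a)) p" for a
    by (rule Exists.IH) (simp add: Exists.prems)
  then show ?case by simp
qed

lemma tm_val_rename_tm: "tm_val M e (rename_tm f t) = tm_val M (\<lambda>i. e (f i)) t"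
proof (induction t)
  case (Fn g ts)
  then have "map (tm_val M e \<circ> rename_tm f) ts = map (tm_val M (\<lambda>i. e (f i))) ts"
    by auto
  then show ?case by (simp del: map_eq_conv)
qed simp

lemma sat_rename: "sat M e (rename f p) = sat M (\<lambda>i. e (f i)) p"
proof (induction p arbitrary: e f)
  case (Rel r ts)
  have "map (tm_val M e \<circ> rename_tm f) ts = map (tm_val M (\<lambda>i. e (f i))) ts"
    by (auto simp: tm_val_rename_tm)
  then show ?case by (simp del: map_eq_conv)
next
  case (Exists i p)
  define z where "z = (SOME z. z \<notin> f ` free_vars p)"
  have "\<exists>z. z \<notin> f ` free_vars p"
    using ex_new_if_finite[OF infinite_UNIV_nat] finite_free_vars by (metis finite_imageI)
  then have z: "z \<notin> f ` free_vars p"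
    unfolding z_def by (rule someI_ex)
  \<comment> \<open>As no free variable of \<open>p\<close> is sent to \<open>z\<close> by
    \<open>f\<close>, updating \<open>e\<close> at \<open>z\<close> affects only the bound
    variable.\<close>
  have "sat M (e(z := a)) (rename (f(i := z)) p) = sat M ((\<lambda>i. e (f i))(i := a)) p" for a
    unfolding Exists.IH by (rule sat_cong) (use z in auto)
  then show ?case by (simp add: z_def[symmetric] Let_def)
qed (simp_all add: tm_val_rename_tm)

section \<open>Tuples and closure properties of definable sets\<close>

lemma tuples_append: "xs @ ys \<in> tuples A (m + n) \<longleftrightarrow> xs \<in> tuples A m \<and> ys \<in> tuples A n"
  if "length xs = m"
  using that by (auto simp: tuples_def)

lemma in_tuples_appendE:
  assumes "zs \<in> tuples A (m + n)"
  obtains xs ys where "zs = xs @ ys" "xs \<in> tuples A m" "ys \<in> tuples A n"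
proof
  show "zs = take m zs @ drop m zs" by simp
  show "take m zs \<in> tuples A m" "drop m zs \<in> tuples A n"
    using assms set_take_subset[of m zs] set_drop_subset[of m zs] by (auto simp: tuples_def)
qed

lemma tuples_0 [simp]: "tuples A 0 = {[]}"
  by (auto simp: tuples_def)

lemma tuples_1: "tuples A (Suc 0) = (\<lambda>a. [a]) ` A"
  by (auto simp: tuples_def length_Suc_conv)

lemma tuples_Suc_append:
  "xs \<in> tuples A (Suc n) \<longleftrightarrow> (\<exists>ys a. xs = ys @ [a] \<and> ys \<in> tuples A n \<and> a \<in> A)"
  by (cases xs rule: rev_cases) (auto simp: tuples_def)

lemma definable_subset: "definable L M n D \<Longrightarrow> D \<subseteq> tuples (univ M) n"
  by (auto simp: definable_def)

text \<open>A variable of \<open>p\<close> may be sent to any coordinate (\<open>Inl\<close>) or to any parameter (\<open>Inr\<close>).\<close>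

lemma definableI:
  fixes h :: "nat \<Rightarrow> nat + nat"
  assumes "is_formula L p" and "range e \<subseteq> univ M" and "\<And>i j. h i = Inl j \<Longrightarrow> j < n"
    and D: "D = {xs \<in> tuples (univ M) n. sat M (\<lambda>i. case_sum ((!) xs) e (h i)) p}"
  shows "definable L M n D"
proof -
  \<comment> \<open>Parameter \<open>j\<close> becomes the variable \<open>n + j\<close>, past all
    coordinates; the assignment of parameters is shifted accordingly.\<close>
  define g where "g i = (case h i of Inl j \<Rightarrow> j | Inr j \<Rightarrow> n + j)" for i
  have "(\<lambda>i. if g i < n then xs ! g i else e (g i - n)) = (\<lambda>i. case_sum ((!) xs) e (h i))" for xs
    using assms(3) by (auto simp: g_def fun_eq_iff split: sum.split)
  then have "sat M (\<lambda>i. if i < n then xs ! i else e (i - n)) (rename g p) =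
      sat M (\<lambda>i. case_sum ((!) xs) e (h i)) p" for xs
    unfolding sat_rename by simp
  then show ?thesis
    unfolding definable_def D using assms(1,2)
    by (intro exI[of _ "rename g p"] exI[of _ "\<lambda>i. e (i - n)"]) (auto simp: is_formula_rename)
qed

lemma definable_tuples:
  assumes "univ M \<noteq> {}"
  shows "definable L M n (tuples (univ M) n)"
proof -
  obtain a where "a \<in> univ M" using assms by blast
  then show ?thesis
    unfolding definable_def
    by (intro exI[of _ "Eq (Var 0) (Var 0)"] exI[of _ "\<lambda>_. a"]) auto
qed

lemma definable_Neg:
  assumes "definable L M n {xs \<in> tuples (univ M) n. P xs}"
  shows "definable L M n {xs \<in> tuples (univ M) n. \<not> P xs}"
proof -
  obtain p e where p: "is_formula L p" "range e \<subseteq> univ M" and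
    eq: "{xs \<in> tuples (univ M) n. P xs} =
      {xs \<in> tuples (univ M) n. sat M (\<lambda>i. if i < n then xs ! i else e i) p}"
    using assms unfolding definable_def by blast
  show ?thesis
    unfolding definable_def using p eq
    by (intro exI[of _ "Neg p"] exI[of _ e]) (auto simp: set_eq_iff)
qed

lemma definable_Conj:
  assumes "definable L M n {xs \<in> tuples (univ M) n. P xs}"
    and "definable L M n {xs \<in> tuples (univ M) n. Q xs}"
  shows "definable L M n {xs \<in> tuples (univ M) n. P xs \<and> Q xs}"
proof -
  obtain p d where p: "is_formula L p" "range d \<subseteq> univ M" and
    P: "{xs \<in> tuples (univ M) n. P xs} =
      {xs \<in> tuples (univ M) n. sat M (\<lambda>i. if i < n then xs ! i else d i) p}"
    using assms(1) unfolding definable_def by blast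
  obtain q e where q: "is_formula L q" "range e \<subseteq> univ M" and
    Q: "{xs \<in> tuples (univ M) n. Q xs} =
      {xs \<in> tuples (univ M) n. sat M (\<lambda>i. if i < n then xs ! i else e i) q}"
    using assms(2) unfolding definable_def by blast
  \<comment> \<open>The two formulas may assign different parameters to the same variable. The
    variables of \<open>p\<close> go to even and those of \<open>q\<close> to odd numbers, and the
    parameters are interleaved in \<open>c\<close>; \<open>h\<close> identifies the two copies of
    each coordinate.\<close>
  define c where "c i = (if even i then d (i div 2) else e (i div 2))" for i
  define h where "h i = (if i div 2 < n then Inl (i div 2) else Inr i)" for i :: nat
  have 1: "(\<lambda>i. case_sum ((!) xs) c (h (2 * i))) = (\<lambda>i. if i < n then xs ! i else d i)"
    and 2: "(\<lambda>i. case_sum ((!) xs) c (h (2 * i + 1))) = (\<lambda>i. if i < n then xs ! i else e i)" for xs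
    by (auto simp: h_def c_def)
  show ?thesis
  proof (rule definableI)
    show "is_formula L (Conj (rename (\<lambda>i. 2 * i) p) (rename (\<lambda>i. 2 * i + 1) q))"
      using p q by (simp add: is_formula_rename)
    show "range c \<subseteq> univ M" using p q by (auto simp: c_def)
    show "\<And>i j. h i = Inl j \<Longrightarrow> j < n" by (auto simp: h_def split: if_splits)
    show "{xs \<in> tuples (univ M) n. P xs \<and> Q xs} = {xs \<in> tuples (univ M) n.
      sat M (\<lambda>i. case_sum ((!) xs) c (h i)) (Conj (rename (\<lambda>i. 2 * i) p) (rename (\<lambda>i. 2 * i + 1) q))}"
      unfolding sat.simps sat_rename 1 2 using P Q by blast
  qed
qed

lemma definable_iff:
  assumes "definable L M n {xs \<in> tuples (univ M) n. P xs}"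
    and "definable L M n {xs \<in> tuples (univ M) n. Q xs}"
  shows "definable L M n {xs \<in> tuples (univ M) n. P xs \<longleftrightarrow> Q xs}"
proof -
  have "definable L M n {xs \<in> tuples (univ M) n. \<not> (P xs \<and> \<not> Q xs) \<and> \<not> (Q xs \<and> \<not> P xs)}"
    by (intro definable_Conj definable_Neg assms)
  then show ?thesis
    by (rule back_subst[where P = "definable L M n"]) blast
qed

lemma definable_ex_single:
  assumes "definable L M (Suc n) D"
  shows "definable L M n {xs \<in> tuples (univ M) n. \<exists>a \<in> univ M. xs @ [a] \<in> D}"
proof -
  obtain p e where p: "is_formula L p" "range e \<subseteq> univ M" and
    D: "D = {xs \<in> tuples (univ M) (Suc n). sat M (\<lambda>i. if i < Suc n then xs ! i else e i) p}"
    using assms unfolding definable_def by blast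
  \<comment> \<open>Among \<open>n\<close> coordinates the variable \<open>n\<close> is a parameter,
    but the quantifier overwrites it with the last entry.\<close>
  have "(\<lambda>i. if i < n then xs ! i else e i)(n := a) =
      (\<lambda>i. if i < Suc n then (xs @ [a]) ! i else e i)" if "length xs = n" for xs a
    using that by (auto simp: fun_eq_iff nth_append)
  then show ?thesis
    unfolding definable_def using p
    by (intro exI[of _ "Exists n p"] exI[of _ e]) (auto simp: D tuples_def)
qed

lemma definable_ex:
  assumes "definable L M (n + k) D"
  shows "definable L M n {xs \<in> tuples (univ M) n. \<exists>ys \<in> tuples (univ M) k. xs @ ys \<in> D}"
  using assms
proof (induction k arbitrary: D)
  case 0
  then have "D = {xs \<in> tuples (univ M) n. \<exists>ys \<in> tuples (univ M) 0. xs @ ys \<in> D}"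
    using definable_subset[of L M n D] by auto
  with 0 show ?case by simp
next
  case (Suc k)
  have "definable L M n {xs \<in> tuples (univ M) n. \<exists>ys \<in> tuples (univ M) k. xs @ ys \<in>
      {zs \<in> tuples (univ M) (n + k). \<exists>a \<in> univ M. zs @ [a] \<in> D}}"
    using Suc.prems by (intro Suc.IH definable_ex_single) simp
  moreover have "{xs \<in> tuples (univ M) n. \<exists>ys \<in> tuples (univ M) k. xs @ ys \<in>
      {zs \<in> tuples (univ M) (n + k). \<exists>a \<in> univ M. zs @ [a] \<in> D}} =
    {xs \<in> tuples (univ M) n. \<exists>ys \<in> tuples (univ M) (Suc k). xs @ ys \<in> D}" (is "?A = ?B")
  proof
    show "?A \<subseteq> ?B"
    proof clarify
      fix xs ys a
      assume "ys \<in> tuples (univ M) k" "a \<in> univ M" "(xs @ ys) @ [a] \<in> D"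
      then show "\<exists>ys \<in> tuples (univ M) (Suc k). xs @ ys \<in> D"
        by (intro bexI[of _ "ys @ [a]"]) (auto simp: tuples_def)
    qed
    show "?B \<subseteq> ?A"
    proof clarify
      fix xs ys
      assume xs: "xs \<in> tuples (univ M) n" and "ys \<in> tuples (univ M) (Suc k)" "xs @ ys \<in> D"
      then obtain zs z where "ys = zs @ [z]" "zs \<in> tuples (univ M) k" "z \<in> univ M"
        by (auto simp: tuples_Suc_append)
      with xs \<open>xs @ ys \<in> D\<close> show "\<exists>ys \<in> tuples (univ M) k. xs @ ys \<in>
          {zs \<in> tuples (univ M) (n + k). \<exists>a \<in> univ M. zs @ [a] \<in> D}"
        by (intro bexI[of _ zs]) (auto simp: tuples_append tuples_def)
    qed
  qed
  ultimately show ?case by simp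
qed

lemma definable_all:
  assumes "definable L M (n + k) {zs \<in> tuples (univ M) (n + k). P zs}"
  shows "definable L M n {xs \<in> tuples (univ M) n. \<forall>ys \<in> tuples (univ M) k. P (xs @ ys)}"
proof -
  have "definable L M n {xs \<in> tuples (univ M) n. \<not> (\<exists>ys \<in> tuples (univ M) k.
      xs @ ys \<in> {zs \<in> tuples (univ M) (n + k). \<not> P zs})}"
    by (intro definable_Neg definable_ex assms)
  then show ?thesis
    by (rule back_subst[where P = "definable L M n"]) (auto simp: tuples_def)
qed

text \<open>Each pair in \<open>bs\<close> is the start and the length of a block of coordinates.\<close>

lemma definable_blocks:
  assumes "definable L M m D" and "m = sum_list (map snd bs)"
    and "\<And>i l. (i, l) \<in> set bs \<Longrightarrow> i + l \<le> n"
  shows "definable L M n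
    {xs \<in> tuples (univ M) n. concat (map (\<lambda>(i, l). take l (drop i xs)) bs) \<in> D}"
proof -
  obtain p e where p: "is_formula L p" "range e \<subseteq> univ M" and
    D: "D = {xs \<in> tuples (univ M) m. sat M (\<lambda>i. if i < m then xs ! i else e i) p}"
    using assms(1) unfolding definable_def by blast
  \<comment> \<open>\<open>js\<close> lists the coordinates that the blocks select, in order and
    possibly with repetitions.\<close>
  define js where "js = concat (map (\<lambda>(i, l). [i..<i + l]) bs)"
  have "length js = m"
    unfolding js_def assms(2) by (induction bs) auto
  have lt: "i < n" if "i \<in> set js" for i
    using that assms(3) by (fastforce simp: js_def)
  have blocks: "concat (map (\<lambda>(i, l). take l (drop i xs)) bs) = map ((!) xs) js"
    if "length xs = n" for xs :: "'c list"
  proof -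
    have "take l (drop i xs) = map ((!) xs) [i..<i + l]" if "(i, l) \<in> set bs" for i l
      using assms(3)[OF that] \<open>length xs = n\<close> by (intro nth_equalityI) auto
    then show ?thesis
      unfolding js_def map_concat by (auto intro!: arg_cong[where f = concat])
  qed
  \<comment> \<open>A variable \<open>i < m\<close> reads the coordinate \<open>js ! i\<close>; the
    others keep their parameters.\<close>
  define h where "h i = (if i < m then Inl (js ! i) else Inr i)" for i
  have h: "(\<lambda>i. case_sum ((!) xs) e (h i)) = (\<lambda>i. if i < m then map ((!) xs) js ! i else e i)" for xs
    using \<open>length js = m\<close> by (auto simp: h_def)
  show ?thesis
  proof (rule definableI[OF p])
    show "\<And>i j. h i = Inl j \<Longrightarrow> j < n"
      using lt \<open>length js = m\<close> by (auto simp: h_def split: if_splits)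
    have "concat (map (\<lambda>(i, l). take l (drop i xs)) bs) \<in> D \<longleftrightarrow>
        sat M (\<lambda>i. if i < m then map ((!) xs) js ! i else e i) p" if "xs \<in> tuples (univ M) n" for xs
    proof -
      have "length xs = n" "map ((!) xs) js \<in> tuples (univ M) m"
        using that lt \<open>length js = m\<close> by (auto simp: tuples_def)
      then show ?thesis by (simp only: blocks D mem_Collect_eq simp_thms)
    qed
    then show "{xs \<in> tuples (univ M) n. concat (map (\<lambda>(i, l). take l (drop i xs)) bs) \<in> D} =
        {xs \<in> tuples (univ M) n. sat M (\<lambda>i. case_sum ((!) xs) e (h i)) p}"
      unfolding h by blast
  qed
qed

section \<open>Counting by agreement sets\<close>

text \<open>\<open>f u m\<close> stands for the slice of \<open>u\<close> at the point
  \<open>m\<close>. The index set \<open>I\<close> is arbitrary because the induction on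
  \<open>N\<close> passes from \<open>I\<close> to \<open>I - C\<close>, keeping only the members of
  \<open>A\<close> that agree with a fixed \<open>u\<close> exactly on \<open>C\<close>.\<close>

lemma card_le_power_agreement:
  assumes "finite A"
    and "\<And>m. m \<in> I \<Longrightarrow> card ((\<lambda>u. f u m) ` A) \<le> N"
    and "\<And>u. u \<in> A \<Longrightarrow> card ((\<lambda>v. {m \<in> I. f u m = f v m}) ` A) \<le> K"
    and "\<And>u v. u \<in> A \<Longrightarrow> v \<in> A \<Longrightarrow> (\<And>m. m \<in> I \<Longrightarrow> f u m = f v m) \<Longrightarrow> u = v"
  shows "card A \<le> K ^ N"
  using assms
proof (induction N arbitrary: A I)
  case 0
  \<comment> \<open>If \<open>A\<close> is nonempty, it has a slice at each point of
    \<open>I\<close>, so the bound 0 forces \<open>I\<close> to be empty. Then any two members agree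
    everywhere, and the count is at most \<open>K ^ 0\<close>.\<close>
  have "u = v" if "u \<in> A" "v \<in> A" for u v
    using that 0 by fastforce
  then show ?case
    using \<open>finite A\<close> by (simp add: card_le_Suc0_iff_eq)
next
  case (Suc N)
  show ?case
  proof (cases "A = {}")
    case False
    then obtain u where u: "u \<in> A" by blast
    define d where "d v = {m \<in> I. f u m = f v m}" for v
    have B: "card {v \<in> A. d v = C} \<le> K ^ N" for C
    proof (rule Suc.IH)
      let ?B = "{v \<in> A. d v = C}"
      show "finite ?B" using Suc.prems(1) by simp
      fix m assume m: "m \<in> I - C"
      \<comment> \<open>Outside \<open>C\<close> no member of the fibre agrees with \<open>u\<close>, so one value is lost.\<close>
      then have "(\<lambda>v. f v m) ` ?B \<subseteq> (\<lambda>v. f v m) ` A - {f u m}"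
        by (auto simp: d_def)
      then have "card ((\<lambda>v. f v m) ` ?B) \<le> card ((\<lambda>v. f v m) ` A - {f u m})"
        using Suc.prems(1) by (intro card_mono) auto
      also have "\<dots> < card ((\<lambda>v. f v m) ` A)"
        using Suc.prems(1) u by (intro card_Diff1_less) auto
      finally show "card ((\<lambda>v. f v m) ` ?B) \<le> N"
        using Suc.prems(2)[of m] m by simp
    next
      let ?B = "{v \<in> A. d v = C}"
      fix w assume w: "w \<in> ?B"
      \<comment> \<open>The new agreement sets are the old ones minus \<open>C\<close>, so their
        number does not grow.\<close>
      have "{m \<in> I - C. f w m = f v m} = {m \<in> I. f w m = f v m} - C" for v
        by blast
      then have "(\<lambda>v. {m \<in> I - C. f w m = f v m}) ` ?B \<subseteq>
          (\<lambda>X. X - C) ` (\<lambda>v. {m \<in> I. f w m = f v m}) ` A"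
        unfolding image_image by (intro image_subsetI) simp
      then have "card ((\<lambda>v. {m \<in> I - C. f w m = f v m}) ` ?B) \<le>
          card ((\<lambda>v. {m \<in> I. f w m = f v m}) ` A)"
        using Suc.prems(1) by (intro surj_card_le) auto
      then show "card ((\<lambda>v. {m \<in> I - C. f w m = f v m}) ` ?B) \<le> K"
        using Suc.prems(3)[of w] w by simp
    next
      fix v w
      assume v: "v \<in> {v \<in> A. d v = C}" and w: "w \<in> {v \<in> A. d v = C}"
        and eq: "\<And>m. m \<in> I - C \<Longrightarrow> f v m = f w m"
      \<comment> \<open>On \<open>C\<close> both members agree with \<open>u\<close>, hence with
        each other.\<close>
      have "f v m = f w m" if "m \<in> I" for m
      proof (cases "m \<in> C")
        case True
        then have "m \<in> d v" "m \<in> d w" using v w by simp_all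
        then show ?thesis by (simp add: d_def)
      qed (use eq that in simp)
      with v w show "v = w" using Suc.prems(4) by blast
    qed
    \<comment> \<open>\<open>A\<close> is the disjoint union of its fibres under \<open>d\<close>,
      at most \<open>K\<close> in number.\<close>
    have "card A = (\<Sum>C \<in> d ` A. card {v \<in> A. d v = C})"
      using Suc.prems(1) using sum.image_gen[of A "\<lambda>_. 1::nat" d] by simp
    also have "\<dots> \<le> (\<Sum>C \<in> d ` A. K ^ N)"
      by (intro sum_mono B)
    also have "\<dots> \<le> K ^ Suc N"
      using Suc.prems(3)[OF u] by (simp add: d_def)
    finally show ?thesis .
  qed simp
qed

section \<open>Uniform bounds for finite families of sections\<close>

text \<open>\<open>b\<close> is the parameter of the family, \<open>a\<close> labels a member and
  \<open>x\<close> runs through its points. Distinct sections are counted, not labels: different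
  labels may give the same set, so that no quotient has to be carried through the induction.\<close>

definition bounded_sections ::
  "('f, 'r) language \<Rightarrow> ('f, 'r, 'm) struct \<Rightarrow> nat \<Rightarrow> bool" where
  "bounded_sections L M n \<longleftrightarrow>
     (\<forall>k j W S. definable L M (k + j) W \<longrightarrow> definable L M (k + j + n) S \<longrightarrow>
        (\<exists>N. \<forall>b \<in> tuples (univ M) k.
           finite ((\<lambda>a. {x. b @ a @ x \<in> S}) ` {a. b @ a \<in> W}) \<longrightarrow>
           card ((\<lambda>a. {x. b @ a @ x \<in> S}) ` {a. b @ a \<in> W}) \<le> N))"

lemma bounded_sectionsE:
  assumes "bounded_sections L M n" "definable L M (k + j) W" "definable L M (k + j + n) S"
  obtains N where "\<And>b. b \<in> tuples (univ M) k \<Longrightarrow>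
    finite ((\<lambda>a. {x. b @ a @ x \<in> S}) ` {a. b @ a \<in> W}) \<Longrightarrow>
    card ((\<lambda>a. {x. b @ a @ x \<in> S}) ` {a. b @ a \<in> W}) \<le> N"
  using assms unfolding bounded_sections_def by meson

text \<open>The sections consist of empty tuples, so only the two subsets of \<open>{[]}\<close> can
  occur.\<close>

lemma bounded_sections_0: "bounded_sections L M 0"
  unfolding bounded_sections_def
proof (intro allI impI exI ballI)
  fix k j W S b
  assume "definable L M (k + j) W" "definable L M (k + j + 0) S" "b \<in> tuples (univ M) k"
  then have len: "length zs = k + j" if "zs \<in> W \<union> S" for zs
    using that by (auto dest!: definable_subset simp: tuples_def)
  have "x = []" if "b @ a \<in> W" "b @ a @ x \<in> S" for a x
    using that len[of "b @ a"] len[of "b @ a @ x"] by (simp flip: add.assoc)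
  then have "(\<lambda>a. {x. b @ a @ x \<in> S}) ` {a. b @ a \<in> W} \<subseteq> Pow {[]}"
    by blast
  then show "card ((\<lambda>a. {x. b @ a @ x \<in> S}) ` {a. b @ a \<in> W}) \<le> card (Pow {[]::'c list})"
    by (intro card_mono) auto
qed

text \<open>An infinite set has more than \<open>N\<close> elements for every \<open>N\<close>, so
  only the finite members of a family constrain \<open>N\<close>; for a finite \<open>A\<close>,
  \<open>{..<N} \<prec> A\<close> means \<open>N < card A\<close>.\<close>

lemma eliminates_ex_inf_iff:
  "eliminates_ex_inf L M n X \<longleftrightarrow>
     (\<forall>k Y F. definable_family L M n X k Y F \<longrightarrow>
        (\<exists>N. \<forall>a \<in> Y. finite (F a) \<longrightarrow> card (F a) \<le> N))"
proof -
  have "(infinite A \<longleftrightarrow> {..<N} \<prec> A) \<longleftrightarrow> (finite A \<longrightarrow> card A \<le> N)" for N and A :: "'c list set set"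
  proof (cases "finite A")
    case True
    then have "A \<approx> {..<card A}" by (simp add: eqpoll_iff_finite_card)
    then have "{..<N} \<prec> A \<longleftrightarrow> {..<N} \<prec> {..<card A}"
      by (meson lesspoll_eq_trans eqpoll_sym)
    then show ?thesis
      using True by (simp add: lesspoll_iff_finite_card not_less)
  next
    case False
    then show ?thesis
      by (simp add: finite_lesspoll_infinite)
  qed
  then show ?thesis
    unfolding eliminates_ex_inf_def by simp
qed

section \<open>Sections in one variable as unary imaginaries\<close>

text \<open>Identifying the tuples that have the same section turns sections into imaginaries, and
  these are unary because a section is a set of points of \<open>M\<close>. The parameter
  \<open>b\<close> is part of the tuple \<open>b @ a\<close>, so a single quotient \<open>X\<close>
  serves for all \<open>b\<close>.\<close>

lemma bounded_sections_1:
  assumes "univ M \<noteq> {}"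
    and "\<And>n X. unary_imaginaries L M n X \<Longrightarrow> eliminates_ex_inf L M n X"
  shows "bounded_sections L M 1"
  unfolding bounded_sections_def
proof (intro allI impI)
  fix k j W S
  assume W: "definable L M (k + j) W" and S: "definable L M (k + j + 1) S"
  let ?n = "k + j"
  let ?U = "univ M"
  define sec where "sec c = {x. c @ x \<in> S}" for c
  define E where "E = {(c, d). c \<in> tuples ?U ?n \<and> d \<in> tuples ?U ?n \<and> sec c = sec d}"
  define X where "X = tuples ?U ?n // E"
  define R where "R = {(x, m). x \<in> X \<and> m \<in> ?U \<and> (\<exists>c \<in> x. [m] \<in> sec c)}"
  define F where "F b = (\<lambda>a. E `` {b @ a}) ` {a. b @ a \<in> W}" for b
  have WT: "W \<subseteq> tuples ?U ?n" and ST: "S \<subseteq> tuples ?U (?n + 1)"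
    using W S definable_subset by blast+
  have E: "equiv (tuples ?U ?n) E"
    by (rule equivI) (auto simp: E_def refl_on_def sym_def trans_def)
  have cls: "E `` {c} = {d \<in> tuples ?U ?n. sec d = sec c}" if "c \<in> tuples ?U ?n" for c
    using that by (auto simp: E_def)
  have sec_eq: "sec c = {[m] | m. m \<in> ?U \<and> c @ [m] \<in> S}" if "c \<in> tuples ?U ?n" for c
    
  proof -
    have "x \<in> tuples ?U 1" if "c @ x \<in> S" for x
      using that ST \<open>c \<in> tuples ?U ?n\<close> tuples_append[of c ?n x ?U 1] by (auto simp: tuples_def[of _ ?n])
    then show ?thesis by (auto simp: sec_def tuples_1)
  qed
  \<comment> \<open>\<open>E\<close> is definable by quantifying over the point \<open>ms\<close>:
    the block lists form \<open>c @ ms\<close> and \<open>d @ ms\<close> out of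
    \<open>c @ d @ ms\<close>.\<close>
  have "definable L M (?n + ?n) {zs \<in> tuples ?U (?n + ?n). \<forall>ms \<in> tuples ?U 1.
      concat (map (\<lambda>(i, l). take l (drop i (zs @ ms))) [(0, ?n), (?n + ?n, 1)]) \<in> S \<longleftrightarrow>
      concat (map (\<lambda>(i, l). take l (drop i (zs @ ms))) [(?n, ?n), (?n + ?n, 1)]) \<in> S}"
    by (intro definable_all definable_iff definable_blocks[OF S]) auto
  moreover have "{zs \<in> tuples ?U (?n + ?n). \<forall>ms \<in> tuples ?U 1.
      concat (map (\<lambda>(i, l). take l (drop i (zs @ ms))) [(0, ?n), (?n + ?n, 1)]) \<in> S \<longleftrightarrow>
      concat (map (\<lambda>(i, l). take l (drop i (zs @ ms))) [(?n, ?n), (?n + ?n, 1)]) \<in> S} =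
    {c @ d | c d. (c, d) \<in> E}" (is "?A = ?B")
  proof -
    have "zs \<in> ?A \<longleftrightarrow> zs \<in> ?B" for zs
    proof (cases "zs \<in> tuples ?U (?n + ?n)")
      case True
      then obtain c d where zs: "zs = c @ d" and c: "c \<in> tuples ?U ?n" and d: "d \<in> tuples ?U ?n"
        by (rule in_tuples_appendE)
      then have len: "length c = ?n" "length d = ?n" by (auto simp: tuples_def)
      have "zs \<in> ?A \<longleftrightarrow> sec c = sec d"
        unfolding sec_eq[OF c] sec_eq[OF d] using True zs len by (auto simp: tuples_1)
      also have "\<dots> \<longleftrightarrow> zs \<in> ?B"
        using zs len c d by (auto simp: E_def tuples_def)
      finally show ?thesis .
    next
      case False
      then show ?thesis by (auto simp: E_def tuples_append tuples_def)
    qed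
    then show ?thesis by blast
  qed
  ultimately have Edef: "definable L M (?n + ?n) {c @ d | c d. (c, d) \<in> E}" by simp
  have int: "interpretable L M ?n X"
    unfolding interpretable_def X_def using definable_tuples[OF assms(1)] E Edef by blast
  \<comment> \<open>All elements of a class have the same section, so the preimage of
    \<open>R\<close> is \<open>S\<close> itself.\<close>
  have R: "{xs @ [m] | xs m. \<exists>x. xs \<in> x \<and> (x, m) \<in> R} = S"
  proof (intro equalityI subsetI)
    fix z assume "z \<in> {xs @ [m] | xs m. \<exists>x. xs \<in> x \<and> (x, m) \<in> R}"
    then obtain c d m x where *: "z = d @ [m]" "d \<in> x" "x \<in> X" "c \<in> x" "[m] \<in> sec c"
      by (auto simp: R_def)
    then have "(c, d) \<in> E"
      using quotient_eq_iff[OF E, of x x c d] by (simp add: X_def)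
    then have "[m] \<in> sec d" using * by (auto simp: E_def sec_def)
    then show "z \<in> S" using * by (simp add: sec_def)
  next
    fix z assume z: "z \<in> S"
    then obtain c m where c: "z = c @ [m]" "c \<in> tuples ?U ?n" "m \<in> ?U"
      using subsetD[OF ST z] by (auto simp: tuples_Suc_append)
    moreover have "E `` {c} \<in> X" "c \<in> E `` {c}"
      using c equiv_class_self[OF E] by (auto simp: X_def quotientI)
    ultimately show "z \<in> {xs @ [m] | xs m. \<exists>x. xs \<in> x \<and> (x, m) \<in> R}"
      using z by (auto simp: R_def sec_def)
  qed
  have inj: "inj_on (\<lambda>x. {m \<in> ?U. (x, m) \<in> R}) X"
  proof (rule inj_onI)
    fix x y
    assume "x \<in> X" "y \<in> X" and eq: "{m \<in> ?U. (x, m) \<in> R} = {m \<in> ?U. (y, m) \<in> R}"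
    then obtain c d where c: "c \<in> tuples ?U ?n" "x = E `` {c}" and d: "d \<in> tuples ?U ?n" "y = E `` {d}"
      by (auto simp: X_def elim!: quotientE)
    have 1: "(E `` {c}, m) \<in> R \<longleftrightarrow> [m] \<in> sec c" if "c \<in> tuples ?U ?n" "m \<in> ?U" for c m
    proof -
      have "E `` {c} \<in> X" using that by (simp add: X_def quotientI)
      then show ?thesis using that by (auto simp: R_def cls)
    qed
    have "sec c = sec d"
    proof -
      have "[m] \<in> sec c \<longleftrightarrow> [m] \<in> sec d" if "m \<in> ?U" for m
        using eq that unfolding c(2) d(2) 1[OF c(1) that, symmetric] 1[OF d(1) that, symmetric]
        by blast
      moreover have "sec c \<subseteq> (\<lambda>m. [m]) ` ?U" "sec d \<subseteq> (\<lambda>m. [m]) ` ?U"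
        using sec_eq[OF c(1)] sec_eq[OF d(1)] by auto
      ultimately show ?thesis by blast
    qed
    then show "x = y" using c d cls by simp
  qed
  have "R \<subseteq> X \<times> ?U" by (auto simp: R_def)
  then have "unary_imaginaries L M ?n X"
    unfolding unary_imaginaries_def using int S inj by (intro conjI exI[of _ R]) (simp_all add: R)
  then have elim: "eliminates_ex_inf L M ?n X" by (rule assms(2))
  \<comment> \<open>\<open>G\<close> contains the \<open>b @ c @ a\<close> with
    \<open>b @ a \<in> W\<close> and \<open>(b @ a, c) \<in> E\<close>; projecting \<open>a\<close>
    away leaves the graph of the family \<open>F\<close>, with \<open>c\<close> running through the
    classes in \<open>F b\<close>.\<close>
  define G where "G = {ws \<in> tuples ?U (k + ?n + j).
        concat (map (\<lambda>(i, l). take l (drop i ws)) [(0, k), (k + ?n, j)]) \<in> W \<and>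
        concat (map (\<lambda>(i, l). take l (drop i ws)) [(0, k), (k + ?n, j), (k, ?n)])
          \<in> {c @ d | c d. (c, d) \<in> E}}"
  have "definable L M (k + ?n + j) G"
    unfolding G_def
    by (intro definable_Conj definable_blocks[OF W] definable_blocks[OF Edef]) auto
  then have "definable L M (k + ?n) {zs \<in> tuples ?U (k + ?n). \<exists>as \<in> tuples ?U j. zs @ as \<in> G}"
    by (rule definable_ex)
  moreover have "{zs \<in> tuples ?U (k + ?n). \<exists>as \<in> tuples ?U j. zs @ as \<in> G} =
    {b @ c | b c. b \<in> tuples ?U k \<and> (\<exists>x \<in> F b. c \<in> x)}" (is "?A = ?B")
  proof -
    have "zs \<in> ?A \<longleftrightarrow> zs \<in> ?B" for zs
    proof (cases "zs \<in> tuples ?U (k + ?n)")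
      case True
      then obtain b c where zs: "zs = b @ c" and b: "b \<in> tuples ?U k" and c: "c \<in> tuples ?U ?n"
        by (rule in_tuples_appendE)
      then have len: "length b = k" "length c = ?n" by (auto simp: tuples_def)
      have app: "(\<exists>c' d'. b @ a @ c = c' @ d' \<and> (c', d') \<in> E) \<longleftrightarrow> (b @ a, c) \<in> E"
        if "a \<in> tuples ?U j" for a
      proof
        assume "\<exists>c' d'. b @ a @ c = c' @ d' \<and> (c', d') \<in> E"
        then obtain c' d' where *: "(b @ a) @ c = c' @ d'" "(c', d') \<in> E" by auto
        moreover have "length d' = length c" using * len by (auto simp: E_def tuples_def)
        ultimately show "(b @ a, c) \<in> E" by (metis append_eq_append_conv)
      qed (metis append.assoc)
      have "zs @ a \<in> G \<longleftrightarrow> b @ a \<in> W \<and> (b @ a, c) \<in> E" if "a \<in> tuples ?U j" for a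
      proof -
        have "length a = j" "zs @ a \<in> tuples ?U (k + ?n + j)"
          using that True by (auto simp: tuples_def)
        then show ?thesis using len app[OF that] by (simp add: G_def zs)
      qed
      then have "zs \<in> ?A \<longleftrightarrow> (\<exists>a \<in> tuples ?U j. b @ a \<in> W \<and> (b @ a, c) \<in> E)"
        using True by blast
      also have "\<dots> \<longleftrightarrow> (\<exists>a. b @ a \<in> W \<and> (b @ a, c) \<in> E)"
      proof -
        have "a \<in> tuples ?U j" if "b @ a \<in> W" for a
          using that WT tuples_append[OF len(1)] by blast
        then show ?thesis by blast
      qed
      also have "\<dots> \<longleftrightarrow> zs \<in> ?B"
        using b c len by (auto simp: zs F_def tuples_def)
      finally show ?thesis .
    next
      case False
      then show ?thesis
        by (auto simp: F_def E_def tuples_append tuples_def)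
    qed
    then show ?thesis by blast
  qed
  ultimately have "definable_family L M ?n X k (tuples ?U k) F"
    unfolding definable_family_def using definable_tuples[OF assms(1)] WT
    by (auto simp: F_def X_def intro: quotientI)
  then obtain N where N: "\<And>b. b \<in> tuples ?U k \<Longrightarrow> finite (F b) \<Longrightarrow> card (F b) \<le> N"
    using elim[unfolded eliminates_ex_inf_iff, rule_format] by blast
  show "\<exists>N. \<forall>b \<in> tuples ?U k.
           finite ((\<lambda>a. {x. b @ a @ x \<in> S}) ` {a. b @ a \<in> W}) \<longrightarrow>
           card ((\<lambda>a. {x. b @ a @ x \<in> S}) ` {a. b @ a \<in> W}) \<le> N"
  proof (intro exI ballI impI)
    fix b assume b: "b \<in> tuples ?U k"
    let ?A = "(\<lambda>a. {x. b @ a @ x \<in> S}) ` {a. b @ a \<in> W}"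
    assume fin: "finite ?A"
    have A: "?A = (\<lambda>a. sec (b @ a)) ` {a. b @ a \<in> W}" by (simp add: sec_def)
    have cls': "E `` {b @ a} = {d \<in> tuples ?U ?n. sec d = sec (b @ a)}" if "b @ a \<in> W" for a
      using cls WT that by blast
    \<comment> \<open>Each class is determined by its section, so finitely many sections give
      finitely many classes.\<close>
    have "F b = (\<lambda>s. {d \<in> tuples ?U ?n. sec d = s}) ` ?A"
      unfolding A F_def image_image by (intro image_cong) (auto simp: cls')
    then have finF: "finite (F b)" using fin by simp
    \<comment> \<open>Conversely the section is recovered from the class, so there are at most
      \<open>card (F b)\<close> sections.\<close>
    have "sec (b @ a) = \<Union> (sec ` (E `` {b @ a}))" if "b @ a \<in> W" for a
      using that WT by (auto simp: cls')
    then have "?A = (\<lambda>x. \<Union> (sec ` x)) ` F b"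
      unfolding A F_def image_image by (intro image_cong) auto
    then have "card ?A \<le> card (F b)" using finF by (simp add: card_image_le)
    with N[OF b finF] show "card ?A \<le> N" by simp
  qed
qed

section \<open>Adding one coordinate to the sections\<close>

text \<open>Each hypothesis is applied with a longer parameter: \<open>b\<close> with a point
  \<open>m\<close> for the bound \<open>N\<close> on slices, and \<open>b\<close> with the label of
  a reference member for the bound \<open>K\<close> on agreement sets. Both bounds are therefore
  uniform in these additions too.\<close>

lemma bounded_sections_Suc:
  assumes "bounded_sections L M n" "bounded_sections L M 1"
  shows "bounded_sections L M (Suc n)"
  unfolding bounded_sections_def
proof (intro allI impI)
  fix k j W S
  assume W: "definable L M (k + j) W" and S: "definable L M (k + j + Suc n) S"
  let ?U = "univ M"
  have WT: "W \<subseteq> tuples ?U (k + j)" and ST: "S \<subseteq> tuples ?U (k + j + Suc n)"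
    using W S definable_subset by blast+
  \<comment> \<open>Parameter \<open>b @ [m]\<close>, label \<open>a\<close>: the blocks rearrange
    \<open>b @ [m] @ a @ x\<close> into \<open>b @ a @ [m] @ x\<close>, so the sections of
    \<open>S1\<close> are slices at \<open>m\<close>.\<close>
  define W1 where "W1 = {zs \<in> tuples ?U (k + 1 + j).
    concat (map (\<lambda>(i, l). take l (drop i zs)) [(0, k), (k + 1, j)]) \<in> W}"
  define S1 where "S1 = {zs \<in> tuples ?U (k + 1 + j + n).
    concat (map (\<lambda>(i, l). take l (drop i zs)) [(0, k), (k + 1, j), (k, 1), (k + 1 + j, n)]) \<in> S}"
  have "definable L M (k + 1 + j) W1" "definable L M (k + 1 + j + n) S1"
    unfolding W1_def S1_def by (intro definable_blocks[OF W] definable_blocks[OF S]; auto)+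
  then obtain N where N: "\<And>b. b \<in> tuples ?U (k + 1) \<Longrightarrow>
      finite ((\<lambda>a. {x. b @ a @ x \<in> S1}) ` {a. b @ a \<in> W1}) \<Longrightarrow>
      card ((\<lambda>a. {x. b @ a @ x \<in> S1}) ` {a. b @ a \<in> W1}) \<le> N"
    using bounded_sectionsE[OF assms(1)] by metis

  \<comment> \<open>Parameter \<open>b @ a0\<close>, label \<open>a\<close>: the section of
    \<open>S2\<close> consists of the \<open>[m]\<close> at which the sections of \<open>a0\<close>
    and \<open>a\<close> have the same slice.\<close>
  define W2 where "W2 = {zs \<in> tuples ?U (k + j + j).
    concat (map (\<lambda>(i, l). take l (drop i zs)) [(0, k), (k + j, j)]) \<in> W}"
  define S2 where "S2 = {zs \<in> tuples ?U (k + j + j + 1). \<forall>xs \<in> tuples ?U n.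
    concat (map (\<lambda>(i, l). take l (drop i (zs @ xs)))
      [(0, k + j), (k + j + j, 1), (k + j + j + 1, n)]) \<in> S \<longleftrightarrow>
    concat (map (\<lambda>(i, l). take l (drop i (zs @ xs)))
      [(0, k), (k + j, j), (k + j + j, 1), (k + j + j + 1, n)]) \<in> S}"
  have "definable L M (k + j + j) W2" "definable L M (k + j + j + 1) S2"
    unfolding W2_def S2_def
    by (intro definable_all definable_iff definable_blocks[OF W] definable_blocks[OF S]; auto)+
  then obtain K where K: "\<And>b. b \<in> tuples ?U (k + j) \<Longrightarrow>
      finite ((\<lambda>a. {x. b @ a @ x \<in> S2}) ` {a. b @ a \<in> W2}) \<Longrightarrow>
      card ((\<lambda>a. {x. b @ a @ x \<in> S2}) ` {a. b @ a \<in> W2}) \<le> K"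
    using bounded_sectionsE[OF assms(2)] by metis

  show "\<exists>N. \<forall>b \<in> tuples ?U k.
           finite ((\<lambda>a. {x. b @ a @ x \<in> S}) ` {a. b @ a \<in> W}) \<longrightarrow>
           card ((\<lambda>a. {x. b @ a @ x \<in> S}) ` {a. b @ a \<in> W}) \<le> N"
  proof (intro exI ballI impI)
    fix b assume b: "b \<in> tuples ?U k"
    define sec where "sec a = {x. b @ a @ x \<in> S}" for a
    define B where "B = {a. b @ a \<in> W}"
    define slice where "slice s m = {x. m # x \<in> s}" for s :: "'c list set" and m
    assume "finite ((\<lambda>a. {x. b @ a @ x \<in> S}) ` {a. b @ a \<in> W})"
    then have fin: "finite (sec ` B)" by (simp add: sec_def[abs_def] B_def)
    have lb: "length b = k" using b by (simp add: tuples_def)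
    have BT: "a \<in> tuples ?U j" if "a \<in> B" for a
      using that WT lb by (auto simp: B_def tuples_append subset_iff)
    have secT: "sec a \<subseteq> tuples ?U (Suc n)" if "a \<in> tuples ?U j" for a
    proof -
      have "length (b @ a) = k + j" using that lb by (simp add: tuples_def)
      then have "(b @ a) @ x \<in> S \<Longrightarrow> x \<in> tuples ?U (Suc n)" for x
        using ST tuples_append by blast
      then show ?thesis by (auto simp: sec_def)
    qed
    have "card (sec ` B) \<le> K ^ N"
    proof (rule card_le_power_agreement[where I = ?U and f = slice])
      show "finite (sec ` B)" by (rule fin)
    next
      fix m assume m: "m \<in> ?U"
      have B1: "{a. (b @ [m]) @ a \<in> W1} = B"
      proof -
        have "(b @ [m]) @ a \<in> W1 \<longleftrightarrow> a \<in> tuples ?U j \<and> b @ a \<in> W" for a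
          using b lb m by (auto simp: W1_def tuples_def)
        then show ?thesis using BT by (auto simp: B_def)
      qed
      have S1: "{x. (b @ [m]) @ a @ x \<in> S1} = slice (sec a) m" if "a \<in> tuples ?U j" for a
      proof -
        have la: "length a = j" using that by (simp add: tuples_def)
        have "(b @ [m]) @ a @ x \<in> S1 \<longleftrightarrow> x \<in> tuples ?U n \<and> b @ a @ m # x \<in> S" for x
          using that b lb m la by (auto simp: S1_def tuples_def)
        moreover have "x \<in> tuples ?U n" if "b @ a @ m # x \<in> S" for x
          using subsetD[OF secT[OF \<open>a \<in> tuples ?U j\<close>], of "m # x"] that
          by (auto simp: sec_def tuples_def)
        ultimately show ?thesis by (auto simp: slice_def sec_def)
      qed
      \<comment> \<open>The slices at \<open>m\<close> are images of the finitely many sections,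
        which gives the finiteness that the bound \<open>N\<close> presupposes.\<close>
      have "(\<lambda>a. {x. (b @ [m]) @ a @ x \<in> S1}) ` {a. (b @ [m]) @ a \<in> W1} =
          (\<lambda>s. slice s m) ` sec ` B"
        unfolding B1 image_image by (intro image_cong) (use S1 BT in auto)
      moreover have "b @ [m] \<in> tuples ?U (k + 1)" using b m by (simp add: tuples_def)
      ultimately show "card ((\<lambda>s. slice s m) ` sec ` B) \<le> N"
        using N[of "b @ [m]"] fin by simp
    next
      fix u assume "u \<in> sec ` B"
      then obtain a0 where a0: "a0 \<in> B" "u = sec a0" by blast
      have a0T: "a0 \<in> tuples ?U j" by (rule BT[OF a0(1)])
      then have la0: "length a0 = j" by (simp add: tuples_def)
      have B2: "{a. (b @ a0) @ a \<in> W2} = B"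
      proof -
        have "(b @ a0) @ a \<in> W2 \<longleftrightarrow> a \<in> tuples ?U j \<and> b @ a \<in> W" for a
          using b lb a0T la0 by (auto simp: W2_def tuples_def)
        then show ?thesis using BT by (auto simp: B_def)
      qed
      have S2: "{x. (b @ a0) @ a @ x \<in> S2} = (\<lambda>m. [m]) ` {m \<in> ?U. slice u m = slice (sec a) m}"
        if "a \<in> tuples ?U j" for a
      proof -
        have la: "length a = j" using that by (simp add: tuples_def)
        have 1: "(b @ a0) @ a @ [m] \<in> S2 \<longleftrightarrow>
            (\<forall>x \<in> tuples ?U n. b @ a0 @ m # x \<in> S \<longleftrightarrow> b @ a @ m # x \<in> S)" if "m \<in> ?U" for m
          using that \<open>a \<in> tuples ?U j\<close> b lb la la0 a0T
          by (simp add: S2_def) (auto simp: tuples_def)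
        have sl: "slice (sec a) m \<subseteq> tuples ?U n" if "a \<in> tuples ?U j" for a m
          using subsetD[OF secT[OF that]] by (fastforce simp: slice_def tuples_def)
        have 2: "(b @ a0) @ a @ [m] \<in> S2 \<longleftrightarrow> slice u m = slice (sec a) m" if "m \<in> ?U" for m
          unfolding 1[OF that] using sl[OF a0T, of m] sl[OF \<open>a \<in> tuples ?U j\<close>, of m]
          by (auto simp: a0(2) slice_def sec_def)
        have "x \<in> (\<lambda>m. [m]) ` ?U" if "(b @ a0) @ a @ x \<in> S2" for x
          using that lb la la0 by (auto simp: S2_def tuples_def tuples_1[symmetric])
        with 2 show ?thesis by blast
      qed
      \<comment> \<open>The sections of \<open>S2\<close> consist of lists of length one instead of
        points; wrapping is injective on sets and preserves the count.\<close>
      have inj: "inj (\<lambda>X. (\<lambda>m :: 'c. [m]) ` X)"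
        by (intro injI) (simp add: inj_image_eq_iff inj_def)
      have "(\<lambda>a. {x. (b @ a0) @ a @ x \<in> S2}) ` {a. (b @ a0) @ a \<in> W2} =
          (\<lambda>X. (\<lambda>m. [m]) ` X) ` (\<lambda>v. {m \<in> ?U. slice u m = slice v m}) ` sec ` B"
        unfolding B2 image_image by (intro image_cong) (use S2 BT in auto)
      moreover have "b @ a0 \<in> tuples ?U (k + j)" using b a0T by (auto simp: tuples_def)
      ultimately have "card ((\<lambda>X. (\<lambda>m. [m]) ` X) ` (\<lambda>v. {m \<in> ?U. slice u m = slice v m}) ` sec ` B) \<le> K"
        using K[of "b @ a0"] fin by simp
      then show "card ((\<lambda>v. {m \<in> ?U. slice u m = slice v m}) ` sec ` B) \<le> K"
        by (simp add: card_image inj_on_subset[OF inj])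
    next
      fix u v
      assume uv: "u \<in> sec ` B" "v \<in> sec ` B" and eq: "\<And>m. m \<in> ?U \<Longrightarrow> slice u m = slice v m"
      have sub: "u \<subseteq> tuples ?U (Suc n)" "v \<subseteq> tuples ?U (Suc n)"
        using uv secT BT by blast+
      \<comment> \<open>Every tuple of length \<open>Suc n\<close> has a first point, so its
        membership is decided in the slice there.\<close>
      have "x \<in> u \<longleftrightarrow> x \<in> v" if x: "x \<in> tuples ?U (Suc n)" for x
      proof -
        obtain m y where "x = m # y" "m \<in> ?U"
          using x by (auto simp: tuples_def length_Suc_conv)
        with eq[of m] show ?thesis by (auto simp: slice_def)
      qed
      with sub show "u = v" by blast
    qed
    then show "card ((\<lambda>a. {x. b @ a @ x \<in> S}) ` {a. b @ a \<in> W}) \<le> K ^ N"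
      by (simp add: sec_def[abs_def] B_def)
  qed
qed

section \<open>From sections back to interpretable sets\<close>

text \<open>A class is a set of \<open>n\<close>-tuples and is the section of \<open>E\<close> at
  each of its elements. Hence \<open>F b\<close> is itself a family of sections, labelled by the
  elements of its members.\<close>

lemma bounded_sections_eliminates_ex_inf:
  assumes "bounded_sections L M n" "interpretable L M n X"
  shows "eliminates_ex_inf L M n X"
  unfolding eliminates_ex_inf_iff
proof (intro allI impI)
  fix k Y F
  assume fam: "definable_family L M n X k Y F"
  define W where "W = {b @ xs | b xs. b \<in> Y \<and> (\<exists>x \<in> F b. xs \<in> x)}"
  have Y: "definable L M k Y" and FX: "\<And>b. b \<in> Y \<Longrightarrow> F b \<subseteq> X"
    and W: "definable L M (k + n) W"
    using fam unfolding definable_family_def W_def[symmetric] by simp_all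
  obtain D E where D: "definable L M n D" and E: "equiv D E"
    and Edef: "definable L M (n + n) {xs @ ys | xs ys. (xs, ys) \<in> E}" and X: "X = D // E"
    using assms(2) by (auto simp: interpretable_def)
  let ?U = "univ M"
  \<comment> \<open>The block skips \<open>b\<close>: the section of \<open>S\<close> at
    \<open>b @ a\<close> is the class of \<open>a\<close>.\<close>
  define S where "S = {zs \<in> tuples ?U (k + n + n).
    concat (map (\<lambda>(i, l). take l (drop i zs)) [(k, n + n)]) \<in> {xs @ ys | xs ys. (xs, ys) \<in> E}}"
  have "definable L M (k + n + n) S"
    unfolding S_def by (intro definable_blocks[OF Edef]) auto
  then obtain N where N: "\<And>b. b \<in> tuples ?U k \<Longrightarrow>
      finite ((\<lambda>a. {x. b @ a @ x \<in> S}) ` {a. b @ a \<in> W}) \<Longrightarrow>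
      card ((\<lambda>a. {x. b @ a @ x \<in> S}) ` {a. b @ a \<in> W}) \<le> N"
    using bounded_sectionsE[OF assms(1) W] by metis
  have YT: "Y \<subseteq> tuples ?U k" and DT: "D \<subseteq> tuples ?U n"
    using Y D definable_subset by blast+
  have ED: "E \<subseteq> D \<times> D" using E by (rule equiv_type)
  have F: "(\<lambda>a. {x. b @ a @ x \<in> S}) ` {a. b @ a \<in> W} = F b" if b: "b \<in> Y" for b
  proof -
    have lb: "length b = k" using b YT by (auto simp: tuples_def)
    have "b @ a \<in> W \<longleftrightarrow> a \<in> \<Union> (F b)" for a
    proof
      assume "b @ a \<in> W"
      then obtain b' a' where *: "b @ a = b' @ a'" "b' \<in> Y" "a' \<in> \<Union> (F b')"
        by (auto simp: W_def)
      moreover have "length b' = k" using * YT by (auto simp: tuples_def)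
      ultimately show "a \<in> \<Union> (F b)" using lb by simp
    qed (use b in \<open>auto simp: W_def\<close>)
    then have "{a. b @ a \<in> W} = \<Union> (F b)" by auto
    moreover have "(\<lambda>a. {x. b @ a @ x \<in> S}) ` \<Union> (F b) = (\<lambda>a. E `` {a}) ` \<Union> (F b)"
    proof (rule image_cong[OF refl])
      fix a assume "a \<in> \<Union> (F b)"
      then have "a \<in> D" using FX[OF b] E by (auto simp: X dest: in_quotient_imp_subset)
      then have la: "length a = n" and aT: "a \<in> tuples ?U n" using DT by (auto simp: tuples_def)
      have "b @ a @ x \<in> S \<longleftrightarrow> (a, x) \<in> E" for x
      proof
        assume S: "b @ a @ x \<in> S"
        then have "length x = n" using lb la by (auto simp: S_def tuples_def)
        with S obtain a' x' where *: "a @ x = a' @ x'" "(a', x') \<in> E"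
          using lb la by (auto simp: S_def)
        moreover have "length a' = n" using * ED DT by (auto simp: tuples_def)
        ultimately show "(a, x) \<in> E" using la by simp
      next
        assume ax: "(a, x) \<in> E"
        then have "x \<in> tuples ?U n" using ED DT by auto
        then show "b @ a @ x \<in> S"
          using ax lb la aT b YT by (auto simp: S_def tuples_def)
      qed
      then show "{x. b @ a @ x \<in> S} = E `` {a}" by auto
    qed
    \<comment> \<open>Classes are nonempty, so each member of \<open>F b\<close> is the class of one
      of its elements.\<close>
    moreover have "(\<lambda>a. E `` {a}) ` \<Union> (F b) = F b"
    proof -
      have 1: "E `` {a} = x" if "a \<in> x" "x \<in> F b" for a x
        using that FX[OF b] E unfolding X
        by (metis Image_singleton_iff equiv_class_eq_iff quotientE subsetD)
      have 2: "\<exists>a. a \<in> x" if "x \<in> F b" for x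
        using that FX[OF b] in_quotient_imp_non_empty[OF E] unfolding X by blast
      show ?thesis
      proof (intro equalityI subsetI)
        fix x assume x: "x \<in> F b"
        then obtain a where a: "a \<in> x" using 2 by blast
        show "x \<in> (\<lambda>a. E `` {a}) ` \<Union> (F b)"
          using 1[OF a x] a x by (intro image_eqI[of _ _ a]) auto
      qed (use 1 in auto)
    qed
    ultimately show ?thesis by simp
  qed
  show "\<exists>N. \<forall>b \<in> Y. finite (F b) \<longrightarrow> card (F b) \<le> N"
  proof (intro exI ballI impI)
    fix b assume b: "b \<in> Y" "finite (F b)"
    then show "card (F b) \<le> N"
      using N[of b, unfolded F[OF b(1)]] YT by blast
  qed
qed

theorem theorem2p3:
  fixes L :: "('f, 'r) language" and T :: "('f, 'r) fm set"
  assumes "{p. is_formula L p} \<lesssim> (UNIV :: 'm set)"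
    and "complete_theory TYPE('m) L T"
    and "\<forall>(M :: ('f, 'r, 'm) struct) n X.
           is_model L T M \<longrightarrow> unary_imaginaries L M n X \<longrightarrow> eliminates_ex_inf L M n X"
  shows "\<forall>(M :: ('f, 'r, 'm) struct) n X.
           is_model L T M \<longrightarrow> interpretable L M n X \<longrightarrow> eliminates_ex_inf L M n X"
proof (intro allI impI)
  fix M :: "('f, 'r, 'm) struct" and n X
  assume M: "is_model L T M" and X: "interpretable L M n X"
  have "univ M \<noteq> {}" using M by (simp add: is_model_def is_structure_def)
  then have "bounded_sections L M 1"
    using assms(3) M by (blast intro: bounded_sections_1)
  \<comment> \<open>The induction starts at length 0, and each step uses the case of length 1
    again.\<close>
  then have "bounded_sections L M n"
    by (induction n) (auto intro: bounded_sections_0 bounded_sections_Suc)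
  then show "eliminates_ex_inf L M n X"
    using X by (rule bounded_sections_eliminates_ex_inf)
qed

end
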